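(* Let $M\ge 1$ and $1\le K\le M$ be integers and let $0<p<1$. Let $\beta^*_{\mathrm{SIC}}=1+\frac{1}{(K+1)(2^K-1)}$ and $q_0=(1-p)^M$. Then the expected number of users resolved per slot, $\overline{R}_{\mathrm{res,SIC}}$, of the SIC-enabled tree-splitting protocol with parameter $K$ satisfies $$\overline{R}_{\mathrm{res,SIC}}\ \ge\ 1-\frac{\beta^*_{\mathrm{SIC}}-1}{\beta^*_{\mathrm{SIC}}(1-q_0)}\,I_p(K+1,M-K).$$
   Context: SIC-enabled tree-splitting protocol (SIC = successive interference cancellation) with parameter $K\ge1$. Let $T(L)$ be the random number of slots used to resolve a group of $L\ge0$ users, counting the first slot of the group. If $L=0$, exactly one (empty) slot is used: $T(0)=1$. If $1\le L\le K$, exactly $L$ slots are used: $T(L)=L$. If $L>K$, one slot is used (a collision), after which each of the $L$ users independently joins group 1 or group 2 with probability $1/2$ each; let $i$ be the size of group 1. (a) If $1\le i\le L-1$: group 1 is resolved by a fresh run of the protocol for $i$ users, and then group 2 is resolved by a fresh run of the protocol for $L-i$ users except that its first slot is omitted (its content is computed by cancellation), so it costs one slot less than a full run. (b) If $i=0$: one slot is used for the empty group 1, and then group 2 is resolved by a fresh run of the protocol for $L$ users with its first slot omitted, i.e. one slot less than a full run. (c) If $i=L$: group 1 is resolved by a fresh run of the protocol for $L$ users, and no slot is used for group 2. Fresh runs use independent randomness. $S_{\mathrm{SIC}}(L)=\mathbb{E}[T(L)]$. User activity: there are $M$ users, each independently active with probability $p$; $q(L)=\binom{M}{L}p^L(1-p)^{M-L}$,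 $q_0=q(0)=(1-p)^M$, $\hat q(L)=q(L)/(1-q_0)$ for $L\ge1$. Define $$\overline{R}_{\mathrm{res,SIC}}=\sum_{L=1}^M\frac{L}{S_{\mathrm{SIC}}(L)}\,\hat q(L).$$ $I_x(a,b)=B_x(a,b)/B_1(a,b)$, with $B_x(a,b)=\int_0^x t^{a-1}(1-t)^{b-1}\,dt$, is the regularized incomplete beta function, with the convention $I_p(M+1,0)=0$. *)

theory Defs
  imports "HOL-Probability.Probability"
begin

text \<open>
  The distribution of the number \<open>T(L)\<close> of slots, as the least solution of the protocol's
  recursion in \<open>nat spmf\<close>. The mass at \<open>None\<close> is the probability that the resolution never
  terminates. A second group that needs \<open>t\<close> slots in a full run costs \<open>t - 1\<close> slots, because its
  first slot is cancelled; every run uses at least one slot, so the natural-number subtraction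
  never truncates.
\<close>
partial_function (spmf) sic_slots :: "nat \<Rightarrow> nat \<Rightarrow> nat spmf" where
  "sic_slots K L =
    (if L = 0 then return_spmf 1
     else if L \<le> K then return_spmf L
     else bind_spmf (spmf_of_pmf (binomial_pmf L (1/2))) (\<lambda>i.
       if i = 0 then
         bind_spmf (sic_slots K L) (\<lambda>t2. return_spmf (1 + 1 + (t2 - 1)))
       else if i = L then
         bind_spmf (sic_slots K L) (\<lambda>t1. return_spmf (1 + t1))
       else
         bind_spmf (sic_slots K i) (\<lambda>t1.
         bind_spmf (sic_slots K (L - i)) (\<lambda>t2.
           return_spmf (1 + t1 + (t2 - 1))))))"

text \<open>
  The expectation \<open>E[T(L)]\<close>, where a non-terminating resolution counts as infinitely many slots.
  Were it infinite, \<^const>\<open>enn2real\<close> would give \<open>0\<close>, and \<open>L / S_SIC K L\<close> would still be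
  \<open>0\<close> as it should.
\<close>
definition S_SIC :: "nat \<Rightarrow> nat \<Rightarrow> real" where
  "S_SIC K L =
    enn2real (\<integral>\<^sup>+ x. (case x of None \<Rightarrow> \<infinity> | Some t \<Rightarrow> of_nat t) \<partial>measure_pmf (sic_slots K L))"

definition q :: "nat \<Rightarrow> real \<Rightarrow> nat \<Rightarrow> real" where
  "q M p L = real (M choose L) * p ^ L * (1 - p) ^ (M - L)"

definition q_hat :: "nat \<Rightarrow> real \<Rightarrow> nat \<Rightarrow> real" where
  "q_hat M p L = q M p L / (1 - q M p 0)"

definition R_res_SIC :: "nat \<Rightarrow> nat \<Rightarrow> real \<Rightarrow> real" where
  "R_res_SIC K M p = (\<Sum>L = 1..M. real L / S_SIC K L * q_hat M p L)"

definition beta_SIC :: "nat \<Rightarrow> real" where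
  "beta_SIC K = 1 + 1 / ((real K + 1) * (2 ^ K - 1))"

text \<open>
  The factors \<open>0 powr 0 = 0\<close> that arise at the endpoints when an exponent vanishes do not affect
  the integral.
\<close>
definition inc_beta :: "real \<Rightarrow> real \<Rightarrow> real \<Rightarrow> real" where
  "inc_beta x a b = integral {0..x} (\<lambda>t. t powr (a - 1) * (1 - t) powr (b - 1))"

text \<open>For \<open>b = 0\<close> the complete integral diverges; the ratio is then \<open>0\<close> by convention.\<close>
definition reg_inc_beta :: "real \<Rightarrow> real \<Rightarrow> real \<Rightarrow> real" where
  "reg_inc_beta x a b = (if b = 0 then 0 else inc_beta x a b / inc_beta 1 a b)"

end

theory Submission
  imports Defs
begin

text \<open>
  In every case a collision of \<open>L\<close> users costs \<open>T(i) + T(L - i)\<close> slots, since the empty group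
  counts \<open>T(0) = 1\<close>. The bound \<open>E[T(L)] \<le> \<beta> L\<close> for \<open>L > K\<close> therefore follows by strong induction:
  the induction step amounts to \<open>(\<beta> - 1) \<Sum>\<^sub>i\<^sub>\<le>\<^sub>K i (L choose i) \<ge> 1\<close>, which is an equality for
  \<open>L = K + 1\<close>, and the left-hand side increases with \<open>L\<close>. Since \<open>T(L) = L\<close> for \<open>1 \<le> L \<le> K\<close>, the
  throughput is at least \<open>1\<close> minus \<open>1 - 1/\<beta>\<close> times the conditional probability of more than
  \<open>K\<close> active users, and this binomial tail is an incomplete beta function.
\<close>

section \<open>The expected number of slots\<close>

definition slot_count :: "nat option \<Rightarrow> ennreal" where
  "slot_count x = (case x of None \<Rightarrow> \<infinity> | Some t \<Rightarrow> of_nat t)"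

lemma slot_count_simps [simp]: "slot_count None = \<infinity>" "slot_count (Some t) = of_nat t"
  by (simp_all add: slot_count_def)

text \<open>\<open>S_SIC\<close> before \<open>enn2real\<close>: in \<open>ennreal\<close>,
  expectations can be split and compared before finiteness is known.\<close>

definition expected_slots :: "nat \<Rightarrow> nat \<Rightarrow> ennreal" where
  "expected_slots K L = (\<integral>\<^sup>+ x. slot_count x \<partial>measure_pmf (sic_slots K L))"

lemma S_SIC_eq: "S_SIC K L = enn2real (expected_slots K L)"
  by (simp add: S_SIC_def expected_slots_def slot_count_def)

lemma sic_slots_0 [simp]: "sic_slots K 0 = return_spmf 1"
  by (simp add: sic_slots.simps)

lemma sic_slots_le [simp]: "L \<noteq> 0 \<Longrightarrow> L \<le> K \<Longrightarrow> sic_slots K L = return_spmf L"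
  by (simp add: sic_slots.simps)

text \<open>The cost law conditioned on the size \<open>i\<close> of group 1, so that each outcome
  of the split can be estimated before averaging.\<close>

definition collision_slots :: "nat \<Rightarrow> nat \<Rightarrow> nat \<Rightarrow> nat spmf" where
  "collision_slots K L i =
    (if i = 0 then
       bind_spmf (sic_slots K L) (\<lambda>t2. return_spmf (1 + 1 + (t2 - 1)))
     else if i = L then
       bind_spmf (sic_slots K L) (\<lambda>t1. return_spmf (1 + t1))
     else
       bind_spmf (sic_slots K i) (\<lambda>t1.
       bind_spmf (sic_slots K (L - i)) (\<lambda>t2.
         return_spmf (1 + t1 + (t2 - 1)))))"

lemma sic_slots_collision:
  assumes "L > K"
  shows "sic_slots K L = bind_pmf (binomial_pmf L (1/2)) (collision_slots K L)"
  using assms by (subst sic_slots.simps) (simp add: collision_slots_def [abs_def])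

text \<open>Every branch returns \<open>1 + ...\<close>, so no induction over the recursive runs is
  required.\<close>

lemma collision_slots_pos: "Some t \<in> set_pmf (collision_slots K L i) \<Longrightarrow> t > 0"
  by (auto simp: collision_slots_def in_set_spmf [symmetric] set_bind_spmf split: if_splits)

lemma sic_slots_pos:
  assumes "Some t \<in> set_pmf (sic_slots K L)"
  shows "t > 0"
proof (cases "L > K")
  case True
  then show ?thesis using assms by (auto simp: sic_slots_collision intro: collision_slots_pos)
next
  case False
  then show ?thesis using assms by (cases "L = 0") auto
qed

text \<open>\<open>h\<close> is the identity for the full expectation and
  \<open>\<lambda>x. min x (of_nat n)\<close> for the truncated one.\<close>

lemma nn_integral_bind_spmf_slot_count:
  fixes h :: "ennreal \<Rightarrow> ennreal"
  shows "(\<integral>\<^sup>+ x. h (slot_count x) \<partial>measure_pmf (bind_spmf P f)) =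
    (\<integral>\<^sup>+ x. (case x of None \<Rightarrow> h \<infinity> | Some t \<Rightarrow> \<integral>\<^sup>+ y. h (slot_count y) \<partial>measure_pmf (f t)) \<partial>measure_pmf P)"
  unfolding bind_spmf_def nn_integral_bind_pmf
  by (intro nn_integral_cong) (auto split: option.split)

text \<open>The collision slot makes up for the first slot of group 2 saved by cancellation, so the
  total is \<open>t1 + t2\<close>. Non-termination counts as infinite on both sides.\<close>

lemma collision_slots_split:
  assumes "i \<noteq> 0" "i \<noteq> L"
  shows "(\<integral>\<^sup>+ x. slot_count x \<partial>measure_pmf (collision_slots K L i))
    \<le> expected_slots K i + expected_slots K (L - i)"
proof -
  let ?P = "measure_pmf (sic_slots K i)" and ?Q = "measure_pmf (sic_slots K (L - i))"
  have step: "(\<integral>\<^sup>+ y. slot_count y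
      \<partial>measure_pmf (bind_spmf (sic_slots K (L - i)) (\<lambda>t2. return_spmf (1 + t + (t2 - 1)))))
    \<le> of_nat t + expected_slots K (L - i)" for t
  proof -
    have "(\<integral>\<^sup>+ y. slot_count y
      \<partial>measure_pmf (bind_spmf (sic_slots K (L - i)) (\<lambda>t2. return_spmf (1 + t + (t2 - 1)))))
      = (\<integral>\<^sup>+ y. (case y of None \<Rightarrow> \<infinity> | Some t2 \<Rightarrow> of_nat (1 + t + (t2 - 1))) \<partial>?Q)"
      unfolding nn_integral_bind_spmf_slot_count [where h = "\<lambda>x. x"]
      by (intro nn_integral_cong) (auto split: option.split)
    also have "\<dots> \<le> (\<integral>\<^sup>+ y. of_nat t + slot_count y \<partial>?Q)"
    proof (rule nn_integral_mono_AE, unfold AE_measure_pmf_iff, intro ballI)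
      fix y assume y: "y \<in> set_pmf (sic_slots K (L - i))"
      show "(case y of None \<Rightarrow> \<infinity> | Some t2 \<Rightarrow> of_nat (1 + t + (t2 - 1))) \<le> of_nat t + slot_count y"
      proof (cases y)
        case (Some t2)
        \<comment> \<open>Positivity of \<open>t2\<close> makes the natural-number subtraction
          exact.\<close>
        then have "1 + t + (t2 - 1) = t + t2" using y sic_slots_pos by fastforce
        then show ?thesis using Some by (metis of_nat_add option.simps(5) order_refl slot_count_simps(2))
      qed auto
    qed
    also have "\<dots> = of_nat t + expected_slots K (L - i)"
      by (subst nn_integral_add) (auto simp: expected_slots_def)
    finally show ?thesis .
  qed
  have "(\<integral>\<^sup>+ x. slot_count x \<partial>measure_pmf (collision_slots K L i))
    = (\<integral>\<^sup>+ x. (case x of None \<Rightarrow> \<infinity> | Some t \<Rightarrow> \<integral>\<^sup>+ y. slot_count y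
      \<partial>measure_pmf (bind_spmf (sic_slots K (L - i)) (\<lambda>t2. return_spmf (1 + t + (t2 - 1))))) \<partial>?P)"
    using assms
    by (simp only: collision_slots_def if_False nn_integral_bind_spmf_slot_count [where h = "\<lambda>x. x"])
  also have "\<dots> \<le> (\<integral>\<^sup>+ x. slot_count x + expected_slots K (L - i) \<partial>?P)"
    by (intro nn_integral_mono) (use step in \<open>auto split: option.split\<close>)
  also have "\<dots> = expected_slots K i + expected_slots K (L - i)"
    by (subst nn_integral_add) (auto simp: expected_slots_def)
  finally show ?thesis .
qed

section \<open>Truncation and monotone convergence\<close>

definition truncated_slots :: "nat \<Rightarrow> nat \<Rightarrow> nat \<Rightarrow> ennreal" where
  "truncated_slots n K L = (\<integral>\<^sup>+ x. min (slot_count x) (of_nat n) \<partial>measure_pmf (sic_slots K L))"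

lemma truncated_slots_le: "truncated_slots n K L \<le> of_nat n"
proof -
  have "truncated_slots n K L \<le> (\<integral>\<^sup>+ x. of_nat n \<partial>measure_pmf (sic_slots K L))"
    unfolding truncated_slots_def by (intro nn_integral_mono) auto
  then show ?thesis by simp
qed

text \<open>By monotone convergence, any bound on the truncated expectations that is uniform in
  \<open>n\<close> passes to \<open>expected_slots\<close>.\<close>

lemma expected_slots_eq_SUP: "expected_slots K L = (SUP n. truncated_slots n K L)"
proof -
  have "(SUP n. min a (of_nat n)) = a" for a :: ennreal
  proof -
    have "(SUP n. min a (of_nat n :: ennreal)) = min a (SUP n. of_nat n)"
      by (simp add: inf_min [symmetric] inf_SUP)
    then show ?thesis by (simp add: ennreal_SUP_of_nat_eq_top inf_min [symmetric])
  qed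
  then have "expected_slots K L
    = (\<integral>\<^sup>+ x. (SUP n. min (slot_count x) (of_nat n)) \<partial>measure_pmf (sic_slots K L))"
    by (simp add: expected_slots_def)
  also have "\<dots> = (SUP n. truncated_slots n K L)"
    unfolding truncated_slots_def
    by (intro nn_integral_monotone_convergence_SUP)
      (auto simp: incseq_def le_fun_def intro: min.coboundedI2)
  finally show ?thesis .
qed

text \<open>When all users land in one group, the cost is one more than that of a fresh run for
  \<open>L\<close>. The cap survives on the right because capping \<open>1 + a\<close> gives at most
  one more than capping \<open>a\<close>, so the self-referential term stays finite.\<close>

lemma collision_slots_loop:
  assumes "i = 0 \<or> i = L"
  shows "(\<integral>\<^sup>+ x. min (slot_count x) (of_nat n) \<partial>measure_pmf (collision_slots K L i))
    \<le> 1 + truncated_slots n K L"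
proof -
  have min_add: "min (1 + a) b \<le> 1 + min a b" for a b :: ennreal
    by (cases "a \<le> b") (auto simp: min_absorb1 min_absorb2 intro: min.coboundedI1 min.coboundedI2 add_increasing)
  define g where "g t = (if i = 0 then 1 + 1 + (t - 1) else 1 + t)" for t :: nat
  have g: "g t = 1 + t" if "t > 0" for t
    using that by (simp add: g_def)
  have "collision_slots K L i = bind_spmf (sic_slots K L) (\<lambda>t. return_spmf (g t))"
    using assms by (auto simp: collision_slots_def g_def)
  then have "(\<integral>\<^sup>+ x. min (slot_count x) (of_nat n) \<partial>measure_pmf (collision_slots K L i))
    = (\<integral>\<^sup>+ x. (case x of None \<Rightarrow> of_nat n | Some t \<Rightarrow> min (of_nat (g t)) (of_nat n))
        \<partial>measure_pmf (sic_slots K L))"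
    unfolding nn_integral_bind_spmf_slot_count [where h = "\<lambda>x. min x (of_nat n)"]
    by (simp add: nn_integral_bind_spmf_slot_count [where h = "\<lambda>x. min x (of_nat n)"])
      (intro nn_integral_cong, auto split: option.split simp: min_absorb2)
  also have "\<dots> \<le> (\<integral>\<^sup>+ x. 1 + min (slot_count x) (of_nat n) \<partial>measure_pmf (sic_slots K L))"
  proof (rule nn_integral_mono_AE, unfold AE_measure_pmf_iff, intro ballI)
    fix x assume x: "x \<in> set_pmf (sic_slots K L)"
    show "(case x of None \<Rightarrow> of_nat n | Some t \<Rightarrow> min (of_nat (g t)) (of_nat n))
      \<le> 1 + min (slot_count x) (of_nat n)"
    proof (cases x)
      case None
      then show ?thesis by (auto intro: add_increasing simp: min_def)
    next
      case (Some t)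
      then show ?thesis using x min_add [of "of_nat t"] by (simp add: g sic_slots_pos)
    qed
  qed
  also have "\<dots> = 1 + truncated_slots n K L"
    by (subst nn_integral_add) (auto simp: truncated_slots_def)
  finally show ?thesis .
qed

section \<open>The linear bound\<close>

text \<open>The empty group keeps its true cost \<open>1\<close> rather than the linear value
  \<open>0\<close>; this excess is what the slope \<open>beta_SIC K\<close> has to absorb.\<close>

definition slots_bound :: "nat \<Rightarrow> nat \<Rightarrow> real" where
  "slots_bound K L = (if L = 0 then 1 else if L \<le> K then real L else beta_SIC K * real L)"

lemma beta_SIC_gt_1: "1 \<le> K \<Longrightarrow> beta_SIC K > 1"
  by (simp add: beta_SIC_def zero_less_mult_iff one_less_power)

lemma slots_bound_nonneg: "1 \<le> K \<Longrightarrow> slots_bound K L \<ge> 0"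
  using beta_SIC_gt_1 [of K] by (simp add: slots_bound_def)

lemma sum_choose_linear: "(\<Sum>i\<le>n. real (n choose i) * real i) = real n * 2 ^ (n - 1)"
  using arg_cong [OF choose_linear_sum [of n], of real] by (simp add: mult.commute)

text \<open>For \<open>L = Suc K\<close> this is the full sum \<open>Suc K * 2 ^ K\<close> without
  its last term \<open>Suc K\<close>; the coefficients \<open>L choose i\<close> only grow with
  \<open>L\<close>.\<close>

lemma sum_choose_linear_ge:
  assumes "K < L"
  shows "(real K + 1) * (2 ^ K - 1) \<le> (\<Sum>i\<le>K. real (L choose i) * real i)"
proof -
  have "(\<Sum>i\<le>Suc K. real (Suc K choose i) * real i) = real (Suc K) * 2 ^ K"
    using sum_choose_linear [of "Suc K"] by simp
  then have "(real K + 1) * (2 ^ K - 1) = (\<Sum>i\<le>K. real (Suc K choose i) * real i)"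
    by (simp add: algebra_simps)
  also have "\<dots> \<le> (\<Sum>i\<le>K. real (L choose i) * real i)"
    using assms by (intro sum_mono mult_right_mono) (auto intro: binomial_right_mono)
  finally show ?thesis .
qed

text \<open>This is the induction step multiplied by \<open>2 ^ (L - 1)\<close>: the power is not
  \<open>2 ^ L\<close> because the two groups contribute equal sums.\<close>

lemma sum_choose_slots_bound_le:
  assumes "1 \<le> K" "K < L"
  shows "(\<Sum>i\<le>L. real (L choose i) * slots_bound K i) \<le> 2 ^ (L - 1) * (beta_SIC K * real L)"
proof -
  let ?\<beta> = "beta_SIC K" and ?S = "\<Sum>i\<le>K. real (L choose i) * real i"
  \<comment> \<open>Compared with the linear function of slope \<open>?\<beta>\<close>, the bound is
    larger by \<open>1\<close> at \<open>i = 0\<close> and smaller by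
    \<open>(?\<beta> - 1) * i\<close> for \<open>i \<le> K\<close>.\<close>
  have "(\<Sum>i\<le>L. real (L choose i) * slots_bound K i)
      = (\<Sum>i\<le>L. ?\<beta> * (real (L choose i) * real i)) + (\<Sum>i\<le>L. if i = 0 then 1 else 0)
        - (\<Sum>i\<le>L. if i \<in> {..K} then (?\<beta> - 1) * (real (L choose i) * real i) else 0)"
    unfolding sum.distrib [symmetric] sum_subtractf [symmetric]
    by (intro sum.cong refl) (auto simp: slots_bound_def algebra_simps)
  also have "(\<Sum>i\<le>L. if i \<in> {..K} then (?\<beta> - 1) * (real (L choose i) * real i) else 0) = (?\<beta> - 1) * ?S"
    using assms by (subst sum.inter_restrict [symmetric])
      (auto simp: sum_distrib_left Int_absorb1 intro!: sum.cong)
  also have "(\<Sum>i\<le>L. ?\<beta> * (real (L choose i) * real i)) = 2 ^ (L - 1) * (?\<beta> * real L)"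
    by (simp add: sum_distrib_left [symmetric] sum_choose_linear)
  also have "(\<Sum>i\<le>L. if i = 0 then 1 else 0) = (1::real)"
    by simp
  finally have eq: "(\<Sum>i\<le>L. real (L choose i) * slots_bound K i)
      = 2 ^ (L - 1) * (?\<beta> * real L) + 1 - (?\<beta> - 1) * ?S" .
  have "2 ^ K > (1::real)"
    using assms by (simp add: one_less_power)
  then have "1 = (?\<beta> - 1) * ((real K + 1) * (2 ^ K - 1))"
    by (simp add: beta_SIC_def)
  also have "\<dots> \<le> (?\<beta> - 1) * ?S"
    using sum_choose_linear_ge [OF assms(2)] beta_SIC_gt_1 [OF assms(1)]
    by (intro mult_left_mono) auto
  finally show ?thesis using eq by simp
qed

section \<open>Averaging over the fair split\<close>

lemma nn_integral_fair_binomial: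
  assumes "\<And>i. i \<le> L \<Longrightarrow> h i \<ge> 0"
  shows "(\<integral>\<^sup>+ i. ennreal (h i) \<partial>measure_pmf (binomial_pmf L (1/2)))
    = ennreal ((\<Sum>i\<le>L. real (L choose i) * h i) / 2 ^ L)"
proof -
  have "(\<integral>\<^sup>+ i. ennreal (h i) \<partial>measure_pmf (binomial_pmf L (1/2)))
      = ennreal (measure_pmf.expectation (binomial_pmf L (1/2)) h)"
    using assms by (intro nn_integral_eq_integral) (auto simp: AE_measure_pmf_iff)
  also have "measure_pmf.expectation (binomial_pmf L (1/2)) h
      = (\<Sum>i\<le>L. (real (L choose i) * (1/2) ^ i * (1 - 1/2) ^ (L - i)) *\<^sub>R h i)"
    by (rule expectation_binomial_pmf') simp
  also have "\<dots> = (\<Sum>i\<le>L. real (L choose i) * h i / 2 ^ L)"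
  proof (intro sum.cong refl)
    fix i assume "i \<in> {..L}"
    then have "(1/2) ^ i * (1 - 1/2) ^ (L - i) = 1 / (2::real) ^ L"
      by (simp add: power_add [symmetric] power_one_over)
    then show "(real (L choose i) * (1/2) ^ i * (1 - 1/2) ^ (L - i)) *\<^sub>R h i
        = real (L choose i) * h i / 2 ^ L"
      by (simp only: mult.assoc real_scaleR_def) simp
  qed
  also have "\<dots> = (\<Sum>i\<le>L. real (L choose i) * h i) / 2 ^ L"
    by (rule sum_divide_distrib [symmetric])
  finally show ?thesis .
qed

text \<open>The sizes of the two groups have the same law, so the averaged cost of both is twice
  that of group 1.\<close>

lemma sum_choose_reflect:
  fixes f :: "nat \<Rightarrow> real"
  shows "(\<Sum>i\<le>n. real (n choose i) * f (n - i)) = (\<Sum>i\<le>n. real (n choose i) * f i)"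
proof -
  have "(\<Sum>i\<le>n. real (n choose i) * f (n - i)) = (\<Sum>i\<le>n. real (n choose (n - i)) * f (n - i))"
    by (intro sum.cong refl) (metis atMost_iff binomial_symmetric)
  also have "\<dots> = (\<Sum>i\<le>n. real (n choose i) * f i)"
    by (rule sum.reindex_bij_witness [of _ "\<lambda>i. n - i" "\<lambda>i. n - i"]) auto
  finally show ?thesis .
qed

lemma expected_slots_0 [simp]: "expected_slots K 0 = 1"
  by (simp add: expected_slots_def)

lemma expected_slots_le_K [simp]: "L \<noteq> 0 \<Longrightarrow> L \<le> K \<Longrightarrow> expected_slots K L = of_nat L"
  by (simp add: expected_slots_def)

lemma expected_slots_le_bound:
  assumes "1 \<le> K"
  shows "expected_slots K L \<le> ennreal (slots_bound K L)"
proof (induction L rule: less_induct)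
  case (less L)
  show ?case
  proof (cases "L \<le> K")
    case True
    then show ?thesis by (cases "L = 0") (auto simp: slots_bound_def ennreal_of_nat_eq_real_of_nat)
  next
    case False
    then have L: "K < L" "L \<ge> 2" "L \<noteq> 0" using assms by auto
    have "truncated_slots n K L \<le> ennreal (slots_bound K L)" for n
    proof -
      define F where "F = enn2real (truncated_slots n K L)"
      have F: "truncated_slots n K L = ennreal F" "F \<ge> 0"
        unfolding F_def
        using le_less_trans [OF truncated_slots_le of_nat_less_top]
        by (auto intro: ennreal_enn2real [symmetric])
      \<comment> \<open>The recursion for \<open>L\<close> refers to \<open>L\<close> itself; the truncation makes that term finite, so that
        it can be moved to the other side.\<close>
      define V where "V = (slots_bound K)(L := F)"
      have V: "V i \<ge> 0" for i
        using F slots_bound_nonneg [OF assms] by (simp add: V_def)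
      have step: "(\<integral>\<^sup>+ x. min (slot_count x) (of_nat n) \<partial>measure_pmf (collision_slots K L i))
        \<le> ennreal (V i + V (L - i))" if "i \<le> L" for i
      proof (cases "i = 0 \<or> i = L")
        case True
        \<comment> \<open>One group is empty, and its cost \<open>V 0 = 1\<close> is exactly the
          extra slot of the loop; the other contributes \<open>V L = F\<close>.\<close>
        have "V i + V (L - i) = 1 + F"
          using True L by (auto simp: V_def slots_bound_def)
        then show ?thesis
          using collision_slots_loop [OF True, of K n] F by (simp add: ennreal_plus)
      next
        case False
        have "(\<integral>\<^sup>+ x. min (slot_count x) (of_nat n) \<partial>measure_pmf (collision_slots K L i))
          \<le> (\<integral>\<^sup>+ x. slot_count x \<partial>measure_pmf (collision_slots K L i))"
          by (intro nn_integral_mono) auto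
        also have "\<dots> \<le> expected_slots K i + expected_slots K (L - i)"
          using False by (intro collision_slots_split) auto
        also have "\<dots> \<le> ennreal (slots_bound K i) + ennreal (slots_bound K (L - i))"
          using False that by (intro add_mono less.IH) auto
        also have "\<dots> = ennreal (V i + V (L - i))"
        proof -
          have "L - i \<noteq> L" using False that by linarith
          then show ?thesis
            using False slots_bound_nonneg [OF assms] by (simp add: V_def ennreal_plus)
        qed
        finally show ?thesis .
      qed
      have "ennreal F = (\<integral>\<^sup>+ i. (\<integral>\<^sup>+ x. min (slot_count x) (of_nat n)
          \<partial>measure_pmf (collision_slots K L i)) \<partial>measure_pmf (binomial_pmf L (1/2)))"
        using L by (simp add: F(1) [symmetric] truncated_slots_def sic_slots_collision)
      also have "\<dots> \<le> (\<integral>\<^sup>+ i. ennreal (V i + V (L - i)) \<partial>measure_pmf (binomial_pmf L (1/2)))"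
        by (intro nn_integral_mono_AE) (auto simp: AE_measure_pmf_iff intro: step)
      also have "\<dots> = ennreal ((\<Sum>i\<le>L. real (L choose i) * (V i + V (L - i))) / 2 ^ L)"
        using V by (intro nn_integral_fair_binomial) auto
      finally have "F \<le> (\<Sum>i\<le>L. real (L choose i) * (V i + V (L - i))) / 2 ^ L"
        using V by (subst (asm) ennreal_le_iff) (auto intro!: divide_nonneg_nonneg sum_nonneg)
      also have "(\<Sum>i\<le>L. real (L choose i) * (V i + V (L - i))) = 2 * (\<Sum>i\<le>L. real (L choose i) * V i)"
        by (simp add: distrib_left sum.distrib sum_choose_reflect)
      \<comment> \<open>\<open>V\<close> differs from \<open>slots_bound K\<close> only at
        \<open>i = L\<close>, where the binomial coefficient is \<open>1\<close>.\<close>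
      also have "(\<Sum>i\<le>L. real (L choose i) * V i)
          = (\<Sum>i\<le>L. real (L choose i) * slots_bound K i) - slots_bound K L + F"
      proof -
        have "{..L} = insert L {..<L}" by auto
        then show ?thesis by (simp add: V_def)
      qed
      also have "(2::real) ^ L = 2 * 2 ^ (L - 1)"
        using L by (cases L) auto
      finally have "F \<le> ((\<Sum>i\<le>L. real (L choose i) * slots_bound K i) - slots_bound K L + F) / 2 ^ (L - 1)"
        by (simp only: mult_divide_mult_cancel_left_if) simp
      then have "F * 2 ^ (L - 1) \<le> (\<Sum>i\<le>L. real (L choose i) * slots_bound K i) - slots_bound K L + F"
        by (simp add: field_simps)
      also have "\<dots> \<le> 2 ^ (L - 1) * slots_bound K L - slots_bound K L + F"
        using sum_choose_slots_bound_le [OF assms L(1)] L by (simp add: slots_bound_def)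
      \<comment> \<open>The outcomes \<open>i = 0\<close> and \<open>i = L\<close> leave
        \<open>F\<close> on the right with total weight \<open>1 / 2 ^ (L - 1)\<close>. This is
        below \<open>1\<close> since \<open>L \<ge> 2\<close>, so \<open>F\<close> can be collected
        on the left.\<close>
      finally have "(2 ^ (L - 1) - 1) * F \<le> (2 ^ (L - 1) - 1) * slots_bound K L"
        by (simp add: algebra_simps)
      moreover have "(2::real) ^ (L - 1) - 1 > 0"
        using L by (simp add: one_less_power)
      ultimately have "F \<le> slots_bound K L" by simp
      then show ?thesis using F by (simp add: ennreal_leI)
    qed
    then show ?thesis by (simp add: expected_slots_eq_SUP SUP_least)
  qed
qed

section \<open>Transfer to the real-valued expectation\<close>

lemma expected_slots_ge_1: "1 \<le> expected_slots K L"
proof -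
  have "(\<integral>\<^sup>+ x. 1 \<partial>measure_pmf (sic_slots K L)) \<le> expected_slots K L"
    unfolding expected_slots_def
  proof (rule nn_integral_mono_AE, unfold AE_measure_pmf_iff, intro ballI)
    fix x assume x: "x \<in> set_pmf (sic_slots K L)"
    show "1 \<le> slot_count x"
    proof (cases x)
      case (Some t)
      then have "1 \<le> t" using x sic_slots_pos by fastforce
      then show ?thesis using Some by (metis of_nat_1 of_nat_mono slot_count_simps(2))
    qed auto
  qed
  then show ?thesis by simp
qed

lemma S_SIC_le_K: "L \<noteq> 0 \<Longrightarrow> L \<le> K \<Longrightarrow> S_SIC K L = real L"
  by (simp add: S_SIC_eq)

text \<open>\<open>enn2real\<close> sends both \<open>0\<close> and infinity to \<open>0\<close>, so
  the lower bound \<open>1\<close> and the finite upper bound both enter.\<close>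

lemma S_SIC_pos:
  assumes "1 \<le> K"
  shows "S_SIC K L > 0"
proof -
  have "expected_slots K L < \<top>"
    using expected_slots_le_bound [OF assms] by (rule le_less_trans) simp
  then show ?thesis
    using less_le_trans [OF zero_less_one expected_slots_ge_1 [of K L]]
    by (simp add: S_SIC_eq enn2real_positive_iff)
qed

lemma S_SIC_le_beta:
  assumes "1 \<le> K" "K < L"
  shows "S_SIC K L \<le> beta_SIC K * real L"
  using enn2real_mono [OF expected_slots_le_bound [OF assms(1)], of L] assms
    slots_bound_nonneg [OF assms(1), of L]
  by (simp add: S_SIC_eq slots_bound_def)

section \<open>The binomial tail as an incomplete beta function\<close>

lemma q_sum: "(\<Sum>L\<le>M. q M p L) = 1"
  using binomial_ring [of p "1 - p" M] by (simp add: q_def)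

text \<open>The derivative of each \<open>q M x L\<close> is a difference of consecutive terms, so
  the sum telescopes; the upper end vanishes because \<open>M choose Suc M = 0\<close>.\<close>

lemma binomial_tail_has_derivative:
  assumes "K < M"
  shows "((\<lambda>x. \<Sum>L=Suc K..M. q M x L) has_real_derivative
    real (Suc K) * real (M choose Suc K) * (x ^ K * (1 - x) ^ (M - Suc K))) (at x)"
proof -
  define g where "g L = real L * real (M choose L) * x ^ (L - 1) * (1 - x) ^ (M - L)" for L
  have deriv: "((\<lambda>x. q M x L) has_real_derivative g L - g (Suc L)) (at x)" for L
  proof -
    \<comment> \<open>Differentiating the factor \<open>(1 - x) ^ (M - L)\<close> yields the
      left-hand coefficient; absorption turns it into that of \<open>g (Suc L)\<close>.\<close>
    have "(M - L) * (M choose L) = Suc L * (M choose Suc L)"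
      by (simp only: binomial_absorb_comp binomial_absorption)
    then have "real (M - L) * real (M choose L) = real (Suc L) * real (M choose Suc L)"
      by (metis of_nat_mult)
    then have "g (Suc L) = real (M - L) * real (M choose L) * x ^ L * (1 - x) ^ (M - L - 1)"
      by (simp add: g_def)
    then show ?thesis
      unfolding q_def
      by (auto intro!: derivative_eq_intros simp: g_def algebra_simps)
  qed
  have "((\<lambda>x. \<Sum>L=Suc K..M. q M x L) has_real_derivative (\<Sum>L=Suc K..M. g L - g (Suc L))) (at x)"
    by (intro DERIV_sum deriv)
  also have "(\<Sum>L=Suc K..M. g L - g (Suc L)) = g (Suc K) - g (Suc M)"
    using assms sum_Suc_diff [of "Suc K" M "\<lambda>L. - g L"] by simp
  also have "\<dots> = real (Suc K) * real (M choose Suc K) * (x ^ K * (1 - x) ^ (M - Suc K))"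
    by (simp add: g_def)
  finally show ?thesis .
qed

lemma inc_beta_eq_binomial_tail:
  assumes "K < M" "0 \<le> x" "x \<le> 1"
  shows "real (Suc K) * real (M choose Suc K) * inc_beta x (real K + 1) (real M - real K)
    = (\<Sum>L=Suc K..M. q M x L)"
proof -
  define c where "c = real (Suc K) * real (M choose Suc K)"
  define F where "F = (\<lambda>x. \<Sum>L=Suc K..M. q M x L)"
  let ?f = "\<lambda>t::real. t powr (real K + 1 - 1) * (1 - t) powr (real M - real K - 1)"
  have "F 0 = 0"
    unfolding F_def by (intro sum.neutral) (auto simp: q_def)
  have deriv: "(F has_vector_derivative c * (t ^ K * (1 - t) ^ (M - Suc K))) (at t within {0..x})" for t
    unfolding F_def c_def has_real_derivative_iff_has_vector_derivative [symmetric]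
    by (rule has_field_derivative_at_within [OF binomial_tail_has_derivative [OF assms(1)]])
  have "((\<lambda>t. c * (t ^ K * (1 - t) ^ (M - Suc K))) has_integral F x - F 0) {0..x}"
    by (rule fundamental_theorem_of_calculus) (use assms deriv in auto)
  \<comment> \<open>At the endpoints \<open>0 powr 0 = 0\<close> differs from
    \<open>0 ^ 0 = 1\<close>, so the two integrands are matched only off
    \<open>{0, 1}\<close>.\<close>
  then have "((\<lambda>t. c * ?f t) has_integral F x) {0..x}"
    unfolding \<open>F 0 = 0\<close> diff_zero
  proof (rule has_integral_spike_finite [where S = "{0, 1}", rotated 2])
    fix t assume "t \<in> {0..x} - {0, 1}"
    then have t: "0 < t" "t < 1" using assms by auto
    have "real M - real K - 1 = real (M - Suc K)" "real K + 1 - 1 = real K"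
      using assms by auto
    then show "c * ?f t = c * (t ^ K * (1 - t) ^ (M - Suc K))"
      using t by (simp only: powr_realpow diff_gt_0_iff_gt)
  qed simp
  then have "c * inc_beta x (real K + 1) (real M - real K) = F x"
    unfolding inc_beta_def integral_mult_right [symmetric] by (rule integral_unique)
  then show ?thesis by (simp only: c_def F_def)
qed

text \<open>The tail equals \<open>1\<close> at \<open>p = 1\<close>, which identifies the complete
  integral as \<open>1 / c\<close>. For \<open>K = M\<close> the convention \<open>0\<close> matches
  the empty sum.\<close>

lemma reg_inc_beta_eq_binomial_tail:
  assumes "K \<le> M" "0 \<le> p" "p \<le> 1"
  shows "reg_inc_beta p (real K + 1) (real M - real K) = (\<Sum>L=Suc K..M. q M p L)"
proof (cases "K = M")
  case True
  then show ?thesis by (simp add: reg_inc_beta_def)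
next
  case False
  then have KM: "K < M" using assms by simp
  define c where "c = real (Suc K) * real (M choose Suc K)"
  have "(\<Sum>L=Suc K..M. q M 1 L) = (\<Sum>L=Suc K..M. if L = M then 1 else 0)"
    by (intro sum.cong) (auto simp: q_def)
  then have "(\<Sum>L=Suc K..M. q M 1 L) = 1" using KM by simp
  then have "c * inc_beta 1 (real K + 1) (real M - real K) = 1"
    using inc_beta_eq_binomial_tail [OF KM, of 1] by (simp only: c_def)
  then have "inc_beta 1 (real K + 1) (real M - real K) = 1 / c"
    by (metis mult_zero_left nonzero_mult_div_cancel_left zero_neq_one)
  then have "reg_inc_beta p (real K + 1) (real M - real K)
      = c * inc_beta p (real K + 1) (real M - real K)"
    using KM by (simp add: reg_inc_beta_def)
  then show ?thesis
    using inc_beta_eq_binomial_tail [OF KM assms(2,3)] by (simp only: c_def)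
qed

section \<open>The throughput bound\<close>

theorem theorem8:
  fixes M K :: nat and p :: real
  assumes "M \<ge> 1" and "1 \<le> K" and "K \<le> M" and "0 < p" and "p < 1"
  defines "q0 \<equiv> (1 - p) ^ M"
  shows "R_res_SIC K M p \<ge>
    1 - (beta_SIC K - 1) / (beta_SIC K * (1 - q0)) * reg_inc_beta p (real K + 1) (real M - real K)"
proof -
  let ?\<beta> = "beta_SIC K" and ?tail = "\<Sum>L=Suc K..M. q M p L"
  have \<beta>: "?\<beta> > 1" using beta_SIC_gt_1 assms by simp
  have q0: "q M p 0 = q0" by (simp add: q_def q0_def)
  have q0_less: "1 - q0 > 0"
    using assms by (simp add: q0_def power_less_one_iff)
  have q_nonneg: "q M p L \<ge> 0" for L using assms by (simp add: q_def)
  have "{..M} = insert 0 {1..M}" by auto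
  then have total: "(\<Sum>L=1..M. q M p L) = 1 - q0"
    using q_sum [of M p] by (simp add: q0)
  \<comment> \<open>The value \<open>1 / ?\<beta>\<close> is written as \<open>1\<close> minus a
    loss, so that summing the losses against \<open>q M p L\<close> produces the tail.\<close>
  have ratio: "1 - (if K < L then (?\<beta> - 1) / ?\<beta> else 0) \<le> real L / S_SIC K L" if "L \<in> {1..M}" for L
  proof (cases "K < L")
    case True
    have "1 - (?\<beta> - 1) / ?\<beta> = real L / (?\<beta> * real L)"
      using True \<beta> by (simp add: field_simps)
    also have "\<dots> \<le> real L / S_SIC K L"
      using True assms(2) by (intro divide_left_mono S_SIC_le_beta mult_pos_pos S_SIC_pos) 
        (use \<beta> in auto)
    finally show ?thesis using True by simp
  next
    case False
    then show ?thesis using that by (simp add: S_SIC_le_K)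
  qed
  \<comment> \<open>The leading \<open>1\<close> is the total conditional probability of the values
    \<open>1..M\<close>; expressing it so puts everything over \<open>1 - q0\<close> and allows a
    comparison term by term.\<close>
  have "1 - (?\<beta> - 1) / (?\<beta> * (1 - q0)) * ?tail
      = ((\<Sum>L=1..M. q M p L) - (?\<beta> - 1) / ?\<beta> * ?tail) / (1 - q0)"
    using q0_less \<beta> unfolding total by (simp add: field_simps)
  also have "(\<Sum>L=1..M. q M p L) - (?\<beta> - 1) / ?\<beta> * ?tail
      = (\<Sum>L=1..M. (1 - (if K < L then (?\<beta> - 1) / ?\<beta> else 0)) * q M p L)"
  proof -
    have "?tail = (\<Sum>L\<in>{1..M} \<inter> {L. K < L}. q M p L)"
      by (intro sum.cong) auto
    also have "\<dots> = (\<Sum>L=1..M. if K < L then q M p L else 0)"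
      by (subst sum.inter_restrict) simp_all
    finally show ?thesis
      by (simp only: sum_distrib_left sum_subtractf [symmetric])
        (intro sum.cong, auto simp: algebra_simps)
  qed
  also have "\<dots> / (1 - q0) \<le> (\<Sum>L=1..M. real L / S_SIC K L * q M p L) / (1 - q0)"
    using q0_less by (intro divide_right_mono sum_mono mult_right_mono ratio q_nonneg) auto
  also have "\<dots> = R_res_SIC K M p"
    by (simp add: R_res_SIC_def q_hat_def q0 sum_divide_distrib)
  finally show ?thesis
    using assms by (simp add: reg_inc_beta_eq_binomial_tail)
qed

end
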